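(* Let $n\ge 0$ and $t=(t_1,\dots,t_{n+1})\in\mathbb{F}_2^{n+1}$. Let $$s_1=x_2x_3-x_{j_1}x_4,\qquad s_{2i}=x_{2i+1}x_{2i+3}-x_{j_{2i}}x_{2i+4},\qquad s_{2i+1}=x_{2i+2}x_{2i+3}-x_{j_{2i+1}}x_{2i+4}\quad(1\le i\le n),$$ where $j_1=j_2=0$, $j_3=2$, and for $2\le i\le n$: if $t_{i+1}=0$ then $j_{2i}=j_{2i-2}$ and $j_{2i+1}=2i-1$; if $t_{i+1}=1$ then $j_{2i}=j_{2i-1}$ and $j_{2i+1}=2i$. Then $B=\{s_1,\dots,s_{2n+1}\}$ is a Gröbner basis for the toric ideal $I_{G_n^t}\subset S(n)$ with respect to the degree reverse lexicographic monomial order with $x_0>x_2>x_3>\cdots>x_{2n+4}$.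
   Context: Throughout, $k$ is a field. Ladder-like structures. For $n\ge 0$ and $t=(t_1,\dots,t_{n+1})\in\mathbb{F}_2^{n+1}$, $L_n^t$ is a partially filled array with $\lfloor n/2\rfloor+2$ rows (numbered top to bottom) and $\lceil n/2\rceil+2$ columns (numbered left to right); its nonzero entries are the variables $x_0,x_2,x_3,\dots,x_{2n+4}$ (there is no $x_1$), each occurring exactly once, all other positions being empty. It is defined recursively, with $\widehat t=(t_1,\dots,t_n)$: - $L_0^t$ has first row $x_0,x_2$ and second row $x_3,x_4$ (for both values of $t$). - $L_1^t$ has first row $x_0,x_2,x_5$ and second row $x_3,x_4,x_6$ (for all $t$). - For $n\ge 2$ even, $L_n^t$ is $L_{n-1}^{\widehat t}$ with a new bottom row added whose only nonzero entries are $x_{2n+4}$, in the last column, and $x_{2n+3}$, in the column containing the first (if $t_{n+1}=0$) or the second (if $t_{n+1}=1$) nonzero entry, from left to right, of the row immediately above the new row. - For $n\ge 3$ odd, $L_n^t$ is $L_{n-1}^{\widehat t}$ with a new rightmost column added whose only nonzero entries are $x_{2n+4}$, in the last row, and $x_{2n+3}$, in the row containing the first (if $t_{n+1}=0$) or the second (if $t_{n+1}=1$) nonzero entry, from top to bottom, of the column immediately to the left of the new column. Graphs and toric ideals. $G_n^t$ is the bipartite graph with one vertex for each row and one vertex for each column of $L_n^t$, and, for each nonzero entry $x_j$ of $L_n^t$, one edge (called $x_j$) joining the vertex of its row to the vertex of its column. Let $V$ be its vertex set, $S(n)=k[x_0,x_2,x_3,\dots,x_{2n+4}]$ the polynomial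 ring on the edges, and $I_{G_n^t}$ (the toric ideal) the kernel of the $k$-algebra homomorphism $S(n)\to k[V]$ sending each edge to the product of its two endpoints. *)

theory Defs
  imports
    "HOL-Library.Poly_Mapping"
    "HOL-Library.Z2"
    "HOL-Algebra.RingHom"
begin

section \<open>Polynomial rings\<close>

text \<open>A monomial is its exponent vector, and a polynomial maps monomials to coefficients.
  The polynomial ring over a variable set \<open>V\<close> is the subring of polynomials whose variables
  all lie in \<open>V\<close>.\<close>

type_synonym 'v monomial = "'v \<Rightarrow>\<^sub>0 nat"
type_synonym ('v, 'k) mpoly = "'v monomial \<Rightarrow>\<^sub>0 'k"

definition poly_vars :: "('v, 'k::zero) mpoly \<Rightarrow> 'v set" where
  "poly_vars p = (\<Union>m\<in>Poly_Mapping.keys p. Poly_Mapping.keys m)"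

definition poly_ring :: "'v set \<Rightarrow> ('v, 'k::comm_ring_1) mpoly ring" where
  "poly_ring V = \<lparr>carrier = {p. poly_vars p \<subseteq> V}, mult = (*), one = 1, zero = 0, add = (+)\<rparr>"

definition pvar :: "'v \<Rightarrow> ('v, 'k::comm_ring_1) mpoly" where
  "pvar v = Poly_Mapping.single (Poly_Mapping.single v 1) 1"

definition pconst :: "'k \<Rightarrow> ('v, 'k::comm_ring_1) mpoly" where
  "pconst c = Poly_Mapping.single 0 c"

text \<open>The \<open>k\<close>-algebra homomorphism sending each variable \<open>v\<close> to \<open>f v\<close>.\<close>

definition poly_subst :: "('v \<Rightarrow> ('w, 'k) mpoly) \<Rightarrow> ('v, 'k) mpoly \<Rightarrow> ('w, 'k::comm_ring_1) mpoly"
  where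
  "poly_subst f p = (\<Sum>m\<in>Poly_Mapping.keys p. pconst (Poly_Mapping.lookup p m) *
      (\<Prod>v\<in>Poly_Mapping.keys m. f v ^ Poly_Mapping.lookup m v))"


section \<open>Monomial orders and Groebner bases\<close>

definition mono_deg :: "'v monomial \<Rightarrow> nat" where
  "mono_deg m = (\<Sum>v\<in>Poly_Mapping.keys m. Poly_Mapping.lookup m v)"

text \<open>Degree reverse lexicographic order (strict) where a variable with a \<^emph>\<open>smaller\<close> index is
  \<^emph>\<open>greater\<close>: among monomials of equal degree, the smaller one has the larger exponent at the
  last index at which the two differ.\<close>

definition degrevlex :: "'v::linorder monomial \<Rightarrow> 'v monomial \<Rightarrow> bool" where
  "degrevlex m m' \<longleftrightarrow> mono_deg m < mono_deg m' \<or>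
     mono_deg m = mono_deg m' \<and>
       (\<exists>v. Poly_Mapping.lookup m' v < Poly_Mapping.lookup m v \<and>
            (\<forall>w>v. Poly_Mapping.lookup m w = Poly_Mapping.lookup m' w))"

text \<open>Below, \<open>lt\<close> is the strict version of a monomial order.  The leading monomial and leading
  term are only meaningful for nonzero polynomials.\<close>

definition lead_mono :: "('v monomial \<Rightarrow> 'v monomial \<Rightarrow> bool) \<Rightarrow> ('v, 'k::zero) mpoly \<Rightarrow> 'v monomial"
  where
  "lead_mono lt p =
     (THE m. m \<in> Poly_Mapping.keys p \<and> (\<forall>m'\<in>Poly_Mapping.keys p. m' \<noteq> m \<longrightarrow> lt m' m))"

definition lead_term ::
  "('v monomial \<Rightarrow> 'v monomial \<Rightarrow> bool) \<Rightarrow> ('v, 'k::zero) mpoly \<Rightarrow> ('v, 'k) mpoly" where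
  "lead_term lt p =
     Poly_Mapping.single (lead_mono lt p) (Poly_Mapping.lookup p (lead_mono lt p))"

definition initial_ideal ::
  "'v set \<Rightarrow> ('v monomial \<Rightarrow> 'v monomial \<Rightarrow> bool) \<Rightarrow> ('v, 'k::comm_ring_1) mpoly set
    \<Rightarrow> ('v, 'k) mpoly set" where
  "initial_ideal V lt F = Idl\<^bsub>poly_ring V\<^esub> (lead_term lt ` (F - {0}))"

definition is_groebner_basis ::
  "'v set \<Rightarrow> ('v monomial \<Rightarrow> 'v monomial \<Rightarrow> bool) \<Rightarrow> ('v, 'k::comm_ring_1) mpoly set
    \<Rightarrow> ('v, 'k) mpoly set \<Rightarrow> bool" where
  "is_groebner_basis V lt B I \<longleftrightarrow>
     finite B \<and> B \<subseteq> I \<and> initial_ideal V lt B = initial_ideal V lt I"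


section \<open>Graphs and toric ideals\<close>

text \<open>A graph with named edges; \<open>ends G e\<close> is the set of the two endpoints of the edge \<open>e\<close>.\<close>

record ('v, 'e) graph =
  verts :: "'v set"
  edges :: "'e set"
  ends :: "'e \<Rightarrow> 'v set"

definition toric_map :: "('v, 'e) graph \<Rightarrow> ('e, 'k::field) mpoly \<Rightarrow> ('v, 'k) mpoly" where
  "toric_map G = poly_subst (\<lambda>e. \<Prod>v\<in>ends G e. pvar v)"

definition toric_ideal :: "('v, 'e) graph \<Rightarrow> ('e, 'k::field) mpoly set" where
  "toric_ideal G = a_kernel (poly_ring (edges G)) (poly_ring (verts G)) (toric_map G)"


section \<open>Ladder-like structures\<close>

text \<open>A partially filled array maps a position (row, column), both counted from 1, to the index of
  the variable at that position, or to \<open>None\<close> if the position is empty.\<close>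

type_synonym array = "nat \<times> nat \<Rightarrow> nat option"

definition num_rows :: "nat \<Rightarrow> nat" where
  "num_rows n = n div 2 + 2"

definition num_cols :: "nat \<Rightarrow> nat" where
  "num_cols n = (n + 1) div 2 + 2"  \<comment> \<open>\<open>(n + 1) div 2\<close> is \<open>n/2\<close> rounded up\<close>

definition row_entries :: "array \<Rightarrow> nat \<Rightarrow> nat list" where
  "row_entries L r = sorted_list_of_set {c. L (r, c) \<noteq> None}"

definition col_entries :: "array \<Rightarrow> nat \<Rightarrow> nat list" where
  "col_entries L c = sorted_list_of_set {r. L (r, c) \<noteq> None}"

text \<open>The parameter \<open>(t\<^sub>1, \<dots>, t\<^sub>n\<^sub>+\<^sub>1)\<close> is a list of length \<open>n + 1\<close>.  As lists are indexed from 0,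
  \<open>t\<^sub>i\<close> is \<open>t ! (i - 1)\<close>; in particular \<open>t\<^sub>n\<^sub>+\<^sub>1\<close> is \<open>t ! n\<close>.\<close>

fun ladder_array :: "nat \<Rightarrow> bit list \<Rightarrow> array" where
  "ladder_array 0 t =
     [(1, 1) \<mapsto> 0, (1, 2) \<mapsto> 2,
      (2, 1) \<mapsto> 3, (2, 2) \<mapsto> 4]"
| "ladder_array (Suc 0) t =
     [(1, 1) \<mapsto> 0, (1, 2) \<mapsto> 2, (1, 3) \<mapsto> 5,
      (2, 1) \<mapsto> 3, (2, 2) \<mapsto> 4, (2, 3) \<mapsto> 6]"
| "ladder_array (Suc (Suc m)) t =
     (let n = m + 2;
          L = ladder_array (Suc m) (butlast t);
          choice = (if t ! n = 0 then 0 else 1);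
          r = num_rows n;
          c = num_cols n
      in if even n
         then L((r, c) \<mapsto> 2 * n + 4, (r, row_entries L (r - 1) ! choice) \<mapsto> 2 * n + 3)
         else L((r, c) \<mapsto> 2 * n + 4, (col_entries L (c - 1) ! choice, c) \<mapsto> 2 * n + 3))"

datatype ladder_vertex = Row nat | Col nat

definition array_ends :: "array \<Rightarrow> nat \<Rightarrow> ladder_vertex set" where
  "array_ends L j = (case (THE p. L p = Some j) of (r, c) \<Rightarrow> {Row r, Col c})"

definition ladder_graph :: "nat \<Rightarrow> bit list \<Rightarrow> (ladder_vertex, nat) graph" where
  "ladder_graph n t =
     \<lparr>verts = Row ` {1..num_rows n} \<union> Col ` {1..num_cols n},
      edges = ran (ladder_array n t),
      ends = array_ends (ladder_array n t)\<rparr>"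

definition ladder_vars :: "nat \<Rightarrow> nat set" where
  "ladder_vars n = insert 0 {2..2 * n + 4}"

end

theory Submission
  imports Defs
begin

text \<open>Under the toric map two monomials have the same image exactly when they have the same
  degree at every vertex, the degree of a monomial at a vertex being the sum of the exponents of
  the edges that meet it.  So the monomials fall into fibres, and a polynomial lies in the toric
  ideal iff its coefficients sum to zero over each fibre.  In particular the leading monomial of a
  nonzero element of the ideal is not the least monomial of its fibre.  A finite set of elements of
  the ideal is therefore a Groebner basis as soon as every monomial that no leading monomial of the
  set divides is the least one of its fibre (\<open>toric_groebner_criterion\<close>).

  For the ladder, put its rows and columns into the order
  \<open>Col 1, Row 1, Col 2, Row 2, Col 3, \<dots>\<close> in which the construction creates them, and call them
  \<open>V\<^sub>0, V\<^sub>1, V\<^sub>2, \<dots>\<close>.  The edges with even index form the path: \<open>x\<^sub>2\<^sub>k\<close> joins \<open>V\<^sub>k\<^sub>+\<^sub>1\<close> to \<open>V\<^sub>k\<close>.  An edge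
  with odd index \<open>x\<^sub>2\<^sub>k\<^sub>+\<^sub>1\<close> joins \<open>V\<^sub>k\<^sub>+\<^sub>2\<close> to some earlier vertex, its anchor, which only the bits
  \<open>t\<close> determine (\<open>ladder_array_eq_Some_iff\<close>).  Whatever the anchors are, among the edges of index
  at most \<open>2k\<close> those that meet \<open>V\<^sub>k\<close> are \<open>x\<^sub>2\<^sub>k\<^sub>-\<^sub>3\<close>, \<open>x\<^sub>2\<^sub>k\<^sub>-\<^sub>2\<close> and \<open>x\<^sub>2\<^sub>k\<close>, as far
  as they exist (\<open>incident_upto\<close>).

  Each \<open>s\<close> records a 4-cycle, and its leading monomial is \<open>x\<^sub>2\<^sub>i\<^sub>+\<^sub>1 x\<^sub>2\<^sub>i\<^sub>+\<^sub>3\<close> or \<open>x\<^sub>2\<^sub>i\<^sub>+\<^sub>2 x\<^sub>2\<^sub>i\<^sub>+\<^sub>3\<close>.  Let \<open>m\<close>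
  be a monomial divisible by none of them and \<open>m'\<close> another monomial of its fibre, and look at the
  last index where they differ.  Write \<open>a\<close> for the exponents of \<open>m\<close>.  The degrees at \<open>V\<^sub>i\<^sub>+\<^sub>3\<close> and
  \<open>V\<^sub>i\<^sub>+\<^sub>2\<close>, with the edges after \<open>x\<^sub>2\<^sub>i\<^sub>+\<^sub>4\<close> left out, are \<open>a\<^sub>2\<^sub>i\<^sub>+\<^sub>3 + a\<^sub>2\<^sub>i\<^sub>+\<^sub>4\<close> and
  \<open>a\<^sub>2\<^sub>i\<^sub>+\<^sub>1 + a\<^sub>2\<^sub>i\<^sub>+\<^sub>2 + a\<^sub>2\<^sub>i\<^sub>+\<^sub>4\<close>.  Both bound the exponent of \<open>x\<^sub>2\<^sub>i\<^sub>+\<^sub>4\<close> throughout the fibre, and \<open>m\<close>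
  attains the smaller bound since \<open>a\<^sub>2\<^sub>i\<^sub>+\<^sub>3 = 0\<close> or \<open>a\<^sub>2\<^sub>i\<^sub>+\<^sub>1 = a\<^sub>2\<^sub>i\<^sub>+\<^sub>2 = 0\<close>.  At the other indices the two
  cannot differ last.  So \<open>m\<close> has the larger exponent at the last difference: it is the smaller one
  (\<open>standard_monomial_least_in_fibre\<close>).\<close>

section \<open>The degree reverse lexicographic order\<close>

lemma degrevlex_irrefl: "\<not> degrevlex m m"
  by (auto simp: degrevlex_def)

lemma degrevlex_trans:
  assumes "degrevlex m1 m2" and "degrevlex m2 m3"
  shows "degrevlex m1 m3"
proof (cases "mono_deg m1 = mono_deg m2 \<and> mono_deg m2 = mono_deg m3")
  case True
  then obtain v w where
    v: "Poly_Mapping.lookup m2 v < Poly_Mapping.lookup m1 v"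
      "\<forall>u>v. Poly_Mapping.lookup m1 u = Poly_Mapping.lookup m2 u" and
    w: "Poly_Mapping.lookup m3 w < Poly_Mapping.lookup m2 w"
      "\<forall>u>w. Poly_Mapping.lookup m2 u = Poly_Mapping.lookup m3 u"
    using assms unfolding degrevlex_def by auto
  have "Poly_Mapping.lookup m3 (max v w) < Poly_Mapping.lookup m1 (max v w)"
    using v w by (cases v w rule: linorder_cases) (auto simp: max_def)
  moreover have "\<forall>u>max v w. Poly_Mapping.lookup m1 u = Poly_Mapping.lookup m3 u"
    using v w by auto
  ultimately show ?thesis
    using True unfolding degrevlex_def by auto
qed (use assms in \<open>auto simp: degrevlex_def\<close>)

lemma degrevlex_if_last_difference:
  assumes "mono_deg m = mono_deg m'" and "m \<noteq> m'"
    and "\<And>v. Poly_Mapping.lookup m v \<noteq> Poly_Mapping.lookup m' v \<Longrightarrow>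
           \<forall>w>v. Poly_Mapping.lookup m w = Poly_Mapping.lookup m' w \<Longrightarrow>
           Poly_Mapping.lookup m' v < Poly_Mapping.lookup m v"
  shows "degrevlex m m'"
proof -
  let ?D = "{v. Poly_Mapping.lookup m v \<noteq> Poly_Mapping.lookup m' v}"
  have "?D \<subseteq> Poly_Mapping.keys m \<union> Poly_Mapping.keys m'"
    by (auto simp: in_keys_iff)
  then have fin: "finite ?D"
    by (rule finite_subset) simp
  moreover have ne: "?D \<noteq> {}"
    using assms(2) by (auto intro: poly_mapping_eqI)
  ultimately have "Max ?D \<in> ?D"
    by (rule Max_in)
  moreover have "\<forall>w>Max ?D. Poly_Mapping.lookup m w = Poly_Mapping.lookup m' w"
    using fin by (auto dest: Max_ge)
  ultimately show ?thesis
    using assms(1,3) unfolding degrevlex_def by blast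
qed

lemma degrevlex_total:
  assumes "m \<noteq> m'"
  shows "degrevlex m m' \<or> degrevlex m' m"
proof (rule ccontr)
  assume neither: "\<not> ?thesis"
  then have deg: "mono_deg m = mono_deg m'"
    by (auto simp: degrevlex_def)
  then have "degrevlex m m'"
  proof (rule degrevlex_if_last_difference[OF _ assms])
    fix v
    assume "Poly_Mapping.lookup m v \<noteq> Poly_Mapping.lookup m' v"
      and "\<forall>w>v. Poly_Mapping.lookup m w = Poly_Mapping.lookup m' w"
    then show "Poly_Mapping.lookup m' v < Poly_Mapping.lookup m v"
      using neither deg unfolding degrevlex_def by (metis nat_neq_iff)
  qed
  then show False
    using neither by simp
qed

lemma mono_deg_superset:
  assumes "finite A" and "Poly_Mapping.keys m \<subseteq> A"
  shows "mono_deg m = (\<Sum>v\<in>A. Poly_Mapping.lookup m v)"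
  unfolding mono_deg_def using assms by (intro sum.mono_neutral_left) (auto simp: in_keys_iff)

lemma mono_deg_add: "mono_deg (m + m') = mono_deg m + mono_deg m'"
proof -
  let ?A = "Poly_Mapping.keys m \<union> Poly_Mapping.keys m'"
  have "mono_deg (m + m') = (\<Sum>v\<in>?A. Poly_Mapping.lookup (m + m') v)"
    by (intro mono_deg_superset) (auto simp: in_keys_iff lookup_add)
  also have "\<dots> = mono_deg m + mono_deg m'"
    by (simp add: lookup_add sum.distrib mono_deg_superset[symmetric])
  finally show ?thesis .
qed

lemma degrevlex_quadric:
  fixes a b c d :: "'v::linorder"
  assumes "a < d" "b < d" "c < d"
  shows "degrevlex (Poly_Mapping.single c 1 + Poly_Mapping.single d 1)
           (Poly_Mapping.single a 1 + Poly_Mapping.single b 1)"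
proof -
  have "mono_deg (Poly_Mapping.single x 1) = 1" for x :: 'v
    by (simp add: mono_deg_def)
  then show ?thesis
    using assms unfolding degrevlex_def
    by (auto simp: mono_deg_add lookup_add lookup_single when_def intro!: exI[of _ d])
qed


section \<open>Leading monomials\<close>

lemma lead_mono_eqI:
  assumes "\<And>m m'. lt m m' \<Longrightarrow> \<not> lt m' m"
    and "m \<in> Poly_Mapping.keys p" and "\<And>m'. m' \<in> Poly_Mapping.keys p \<Longrightarrow> m' \<noteq> m \<Longrightarrow> lt m' m"
  shows "lead_mono lt p = m"
  unfolding lead_mono_def
proof (rule the_equality)
  fix m'
  assume "m' \<in> Poly_Mapping.keys p \<and> (\<forall>m\<in>Poly_Mapping.keys p. m \<noteq> m' \<longrightarrow> lt m m')"
  then show "m' = m"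
    using assms by metis
qed (use assms in simp)

lemma lead_mono_greatest:
  assumes trans: "\<And>m1 m2 m3. lt m1 m2 \<Longrightarrow> lt m2 m3 \<Longrightarrow> lt m1 m3"
    and irrefl: "\<And>m. \<not> lt m m"
    and total: "\<And>m m'. m \<noteq> m' \<Longrightarrow> lt m m' \<or> lt m' m"
    and "p \<noteq> 0"
  shows "lead_mono lt p \<in> Poly_Mapping.keys p \<and>
    (\<forall>m\<in>Poly_Mapping.keys p. m \<noteq> lead_mono lt p \<longrightarrow> lt m (lead_mono lt p))"
proof -
  have "\<exists>m\<in>Poly_Mapping.keys p. \<forall>m'\<in>Poly_Mapping.keys p. m' \<noteq> m \<longrightarrow> \<not> lt m m'"
  proof (rule Finite_Set.bex_max_element)
    show "asymp_on (Poly_Mapping.keys p) lt"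
      using irrefl trans by (blast intro: asymp_onI)
    show "transp_on (Poly_Mapping.keys p) lt"
      using trans by (blast intro: transp_onI)
  qed (use \<open>p \<noteq> 0\<close> in simp_all)
  then obtain m where m: "m \<in> Poly_Mapping.keys p" "\<And>m'. m' \<in> Poly_Mapping.keys p \<Longrightarrow> m' \<noteq> m \<Longrightarrow> lt m' m"
    using total by blast
  then have "lead_mono lt p = m"
    using irrefl trans by (metis lead_mono_eqI)
  then show ?thesis
    using m by blast
qed

lemma lead_mono_binomial:
  assumes asym: "\<And>m m'. lt m m' \<Longrightarrow> \<not> lt m' m" and "lt m' m"
  shows "lead_mono lt (Poly_Mapping.single m 1 - Poly_Mapping.single m' 1 ::
    ('v, 'k::field) mpoly) = m"
proof (rule lead_mono_eqI[OF asym])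
  have "m \<noteq> m'"
    using assms by blast
  then show "m \<in> Poly_Mapping.keys (Poly_Mapping.single m 1 - Poly_Mapping.single m' (1 :: 'k))"
    by (simp add: in_keys_iff lookup_minus lookup_single)
next
  fix q
  assume "q \<in> Poly_Mapping.keys (Poly_Mapping.single m 1 - Poly_Mapping.single m' (1 :: 'k))"
    and "q \<noteq> m"
  then have "q = m'"
    by (auto simp: in_keys_iff lookup_minus lookup_single when_def split: if_splits)
  then show "lt q m"
    using assms(2) by simp
qed

lemma exists_monomial_quotient:
  fixes m :: "'v monomial"
  assumes "a \<noteq> b" "Poly_Mapping.lookup m a \<noteq> 0" "Poly_Mapping.lookup m b \<noteq> 0"
  shows "\<exists>u. m = Poly_Mapping.single a 1 + Poly_Mapping.single b 1 + u"
proof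
  show "m = Poly_Mapping.single a 1 + Poly_Mapping.single b 1
      + (m - (Poly_Mapping.single a 1 + Poly_Mapping.single b 1))"
    using assms by (intro poly_mapping_eqI)
      (auto simp: lookup_add lookup_minus lookup_single when_def)
qed


section \<open>Toric ideals\<close>

definition endpoint_mono :: "('v, 'e) graph \<Rightarrow> 'e monomial \<Rightarrow> 'v monomial" where
  "endpoint_mono G m =
     (\<Sum>e\<in>Poly_Mapping.keys m. \<Sum>v\<in>ends G e. Poly_Mapping.single v (Poly_Mapping.lookup m e))"

lemma prod_single_one:
  "(\<Prod>x\<in>A. Poly_Mapping.single (f x) (1 :: 'k :: comm_ring_1)) = Poly_Mapping.single (\<Sum>x\<in>A. f x) 1"
  by (induction A rule: infinite_finite_induct) (simp_all add: mult_single)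

lemma single_one_power:
  "Poly_Mapping.single u (1 :: 'k :: comm_ring_1) ^ n = Poly_Mapping.single (\<Sum>i<n. u) 1"
  by (induction n) (simp_all add: mult_single add.commute)

text \<open>The toric map sends monomials to monomials, so it is determined by \<open>endpoint_mono\<close>.\<close>

lemma toric_map_eq_sum:
  "toric_map G p = (\<Sum>m\<in>Poly_Mapping.keys p.
     Poly_Mapping.single (endpoint_mono G m) (Poly_Mapping.lookup p m))"
proof -
  have "(\<Sum>i<n. \<Sum>v\<in>A. Poly_Mapping.single v (1::nat)) = (\<Sum>v\<in>A. Poly_Mapping.single v n)"
    for A :: "'a set" and n
    by (induction n)
       (simp_all add: sum.distrib[symmetric] single_add[symmetric] add.commute)
  then show ?thesis
    unfolding toric_map_def poly_subst_def pvar_def pconst_def endpoint_mono_def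
    by (simp add: prod_single_one single_one_power mult_single)
qed

lemma lookup_toric_map:
  "Poly_Mapping.lookup (toric_map G p) u =
     (\<Sum>m | m \<in> Poly_Mapping.keys p \<and> endpoint_mono G m = u. Poly_Mapping.lookup p m)"
  by (simp add: toric_map_eq_sum lookup_sum lookup_single when_def sum.inter_filter)

lemma toric_ideal_iff:
  "p \<in> toric_ideal G \<longleftrightarrow> poly_vars p \<subseteq> edges G \<and> toric_map G p = 0"
  by (simp add: toric_ideal_def a_kernel_def kernel_def poly_ring_def)

text \<open>Summing over a fixed set of edges instead of the support of one monomial makes the vertex
  degrees of different monomials comparable term by term.\<close>

lemma lookup_endpoint_mono:
  assumes "finite A" and "Poly_Mapping.keys m \<subseteq> A" and "\<And>e. e \<in> A \<Longrightarrow> finite (ends G e)"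
  shows "Poly_Mapping.lookup (endpoint_mono G m) v =
    (\<Sum>e | e \<in> A \<and> v \<in> ends G e. Poly_Mapping.lookup m e)"
proof -
  have "Poly_Mapping.lookup (endpoint_mono G m) v =
      (\<Sum>e\<in>Poly_Mapping.keys m. if v \<in> ends G e then Poly_Mapping.lookup m e else 0)"
    using assms(2,3)
    by (auto simp: endpoint_mono_def lookup_sum lookup_single when_def intro!: sum.cong)
  also have "\<dots> = (\<Sum>e\<in>A. if v \<in> ends G e then Poly_Mapping.lookup m e else 0)"
    using assms(1,2) by (intro sum.mono_neutral_left) (auto simp: in_keys_iff)
  finally show ?thesis
    using assms(1) by (simp add: sum.inter_filter)
qed

text \<open>Summing the degrees over all vertices counts every edge twice, as in the handshaking lemma; so
  fibres are homogeneous, and only the second clause of \<open>degrevlex\<close> decides within a fibre.\<close>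

lemma mono_deg_eq_if_endpoint_mono_eq:
  assumes two: "\<And>e. e \<in> Poly_Mapping.keys m \<union> Poly_Mapping.keys m' \<Longrightarrow> card (ends G e) = 2"
    and eq: "endpoint_mono G m = endpoint_mono G m'"
  shows "mono_deg m = mono_deg m'"
proof -
  define A where "A = Poly_Mapping.keys m \<union> Poly_Mapping.keys m'"
  let ?W = "\<Union>e\<in>A. ends G e"
  have finA: "finite A"
    by (simp add: A_def)
  have two: "card (ends G e) = 2" if "e \<in> A" for e
    using two that by (auto simp: A_def)
  have fin: "finite (ends G e)" if "e \<in> A" for e
    using two[OF that] card.infinite by fastforce
  have "(\<Sum>v\<in>?W. Poly_Mapping.lookup (endpoint_mono G q) v) = 2 * mono_deg q"
    if q: "Poly_Mapping.keys q \<subseteq> A" for q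
  proof -
    have "(\<Sum>v\<in>?W. Poly_Mapping.lookup (endpoint_mono G q) v)
        = (\<Sum>v\<in>?W. \<Sum>e\<in>A. if v \<in> ends G e then Poly_Mapping.lookup q e else 0)"
      using fin q finA by (simp add: lookup_endpoint_mono[of A] sum.inter_filter)
    also have "\<dots> = (\<Sum>e\<in>A. \<Sum>v\<in>?W. if v \<in> ends G e then Poly_Mapping.lookup q e else 0)"
      by (rule sum.swap)
    also have "\<dots> = (\<Sum>e\<in>A. 2 * Poly_Mapping.lookup q e)"
    proof (rule sum.cong[OF refl])
      fix e assume e: "e \<in> A"
      have "(\<Sum>v\<in>?W. if v \<in> ends G e then Poly_Mapping.lookup q e else 0)
          = (\<Sum>v\<in>ends G e. Poly_Mapping.lookup q e)"
        using fin finA e by (intro sum.mono_neutral_cong_right) auto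
      then show "(\<Sum>v\<in>?W. if v \<in> ends G e then Poly_Mapping.lookup q e else 0) = 2 * Poly_Mapping.lookup q e"
        using two[OF e] by simp
    qed
    also have "\<dots> = (\<Sum>e\<in>Poly_Mapping.keys q. 2 * Poly_Mapping.lookup q e)"
      using q finA by (intro sum.mono_neutral_right) (auto simp: in_keys_iff)
    finally show ?thesis
      by (simp add: mono_deg_def sum_distrib_left)
  qed
  from this[of m] this[of m'] show ?thesis
    using eq by (simp add: A_def)
qed

lemma endpoint_mono_add:
  "endpoint_mono G (m + m') = endpoint_mono G m + endpoint_mono G m'"
proof -
  let ?A = "Poly_Mapping.keys m \<union> Poly_Mapping.keys m'"
  have superset: "endpoint_mono G q
      = (\<Sum>e\<in>?A. \<Sum>v\<in>ends G e. Poly_Mapping.single v (Poly_Mapping.lookup q e))"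
    if "Poly_Mapping.keys q \<subseteq> ?A" for q
    unfolding endpoint_mono_def
    using that by (intro sum.mono_neutral_left) (auto simp: in_keys_iff)
  have "Poly_Mapping.keys (m + m') \<subseteq> ?A"
    by (auto simp: in_keys_iff lookup_add)
  then show ?thesis
    by (simp add: superset lookup_add single_add sum.distrib)
qed

lemma endpoint_mono_single:
  "endpoint_mono G (Poly_Mapping.single e 1) = (\<Sum>v\<in>ends G e. Poly_Mapping.single v 1)"
  by (simp add: endpoint_mono_def)

lemma binomial_in_toric_ideal:
  fixes m m' :: "'e monomial"
  assumes "Poly_Mapping.keys m \<subseteq> edges G" and "Poly_Mapping.keys m' \<subseteq> edges G"
    and eq: "endpoint_mono G m = endpoint_mono G m'"
  shows "(Poly_Mapping.single m 1 - Poly_Mapping.single m' 1 :: ('e, 'k::field) mpoly)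
    \<in> toric_ideal G"
proof -
  let ?p = "Poly_Mapping.single m 1 - Poly_Mapping.single m' 1 :: ('e, 'k) mpoly"
  have keys: "Poly_Mapping.keys ?p \<subseteq> {m, m'}"
    by (auto simp: in_keys_iff lookup_minus lookup_single when_def split: if_splits)
  have "toric_map G ?p = 0"
  proof (cases "m = m'")
    case False
    have "toric_map G ?p = (\<Sum>q\<in>{m, m'}.
        Poly_Mapping.single (endpoint_mono G q) (Poly_Mapping.lookup ?p q))"
      unfolding toric_map_eq_sum
      using keys by (intro sum.mono_neutral_left) (auto simp: in_keys_iff)
    then show ?thesis
      using False eq by (simp add: lookup_minus lookup_single single_add[symmetric])
  qed (simp add: toric_map_eq_sum)
  then show ?thesis
    using keys assms(1,2) by (auto simp: toric_ideal_iff poly_vars_def)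
qed

lemma pvar_mult:
  "pvar a * pvar b = Poly_Mapping.single (Poly_Mapping.single a 1 + Poly_Mapping.single b 1) 1"
  by (simp add: pvar_def mult_single)


section \<open>A Groebner criterion for toric ideals\<close>

text \<open>If the leading monomial \<open>m\<close> of an element of the ideal were not divisible by that of any \<open>b\<close> in
  \<open>B\<close>, it would be the least monomial of its fibre; but the coefficients of that fibre sum to zero,
  so another of its monomials occurs in the element, and that one is smaller than \<open>m\<close>.\<close>

lemma toric_groebner_criterion:
  fixes B :: "('e, 'k::field) mpoly set"
  assumes trans: "\<And>m1 m2 m3. lt m1 m2 \<Longrightarrow> lt m2 m3 \<Longrightarrow> lt m1 m3"
    and irrefl: "\<And>m. \<not> lt m m"
    and total: "\<And>m m'. m \<noteq> m' \<Longrightarrow> lt m m' \<or> lt m' m"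
    and "finite B" and B: "B \<subseteq> toric_ideal G"
    and cover: "\<And>m m'. Poly_Mapping.keys m \<subseteq> edges G \<Longrightarrow> Poly_Mapping.keys m' \<subseteq> edges G \<Longrightarrow>
        endpoint_mono G m' = endpoint_mono G m \<Longrightarrow> m' \<noteq> m \<Longrightarrow>
        (\<And>b u. b \<in> B \<Longrightarrow> b \<noteq> 0 \<Longrightarrow> m \<noteq> lead_mono lt b + u) \<Longrightarrow> lt m m'"
  shows "is_groebner_basis (edges G) lt B (toric_ideal G)"
proof -
  have greatest: "lead_mono lt p \<in> Poly_Mapping.keys p \<and>
      (\<forall>m\<in>Poly_Mapping.keys p. m \<noteq> lead_mono lt p \<longrightarrow> lt m (lead_mono lt p))"
    if "p \<noteq> 0" for p :: "('e, 'k) mpoly"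
    by (rule lead_mono_greatest) (fact trans irrefl total that)+
  have reducible: "\<exists>b\<in>B. b \<noteq> 0 \<and> (\<exists>u. lead_mono lt p = lead_mono lt b + u)"
    if p: "p \<in> toric_ideal G" "p \<noteq> 0" for p :: "('e, 'k) mpoly"
  proof (rule ccontr)
    assume standard: "\<not> ?thesis"
    define m where "m = lead_mono lt p"
    have m: "m \<in> Poly_Mapping.keys p" "\<And>m'. m' \<in> Poly_Mapping.keys p \<Longrightarrow> m' \<noteq> m \<Longrightarrow> lt m' m"
      using greatest[OF p(2)] by (auto simp: m_def)
    let ?F = "{m' \<in> Poly_Mapping.keys p. endpoint_mono G m' = endpoint_mono G m}"
    have "?F \<noteq> {m}"
    proof
      assume "?F = {m}"
      then have "Poly_Mapping.lookup (toric_map G p) (endpoint_mono G m) = Poly_Mapping.lookup p m"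
        by (simp add: lookup_toric_map)
      then show False
        using p m(1) by (simp add: toric_ideal_iff in_keys_iff)
    qed
    then obtain m' where m': "m' \<in> Poly_Mapping.keys p" "endpoint_mono G m' = endpoint_mono G m" "m' \<noteq> m"
      using m(1) by blast
    have "Poly_Mapping.keys m \<subseteq> edges G" "Poly_Mapping.keys m' \<subseteq> edges G"
      using p(1) m(1) m'(1) by (auto simp: toric_ideal_iff poly_vars_def)
    then have "lt m m'"
      using m'(2,3) standard by (intro cover) (auto simp: m_def)
    then show False
      using m(2)[OF m'(1,3)] trans irrefl by blast
  qed
  have "lead_term lt p \<in> I"
    if I: "ideal I (poly_ring (edges G))" "lead_term lt ` (B - {0}) \<subseteq> I"
      and p: "p \<in> toric_ideal G" "p \<noteq> 0" for I and p :: "('e, 'k) mpoly"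
  proof -
    obtain b u where b: "b \<in> B" "b \<noteq> 0" and u: "lead_mono lt p = lead_mono lt b + u"
      using reducible[OF p] by blast
    define c where "c = Poly_Mapping.lookup p (lead_mono lt p) / Poly_Mapping.lookup b (lead_mono lt b)"
    have "Poly_Mapping.lookup b (lead_mono lt b) \<noteq> 0"
      using greatest[OF b(2)] by (simp add: in_keys_iff)
    then have "lead_term lt p = Poly_Mapping.single u c * lead_term lt b"
      by (simp add: lead_term_def mult_single u c_def add.commute)
    moreover have "Poly_Mapping.keys u \<subseteq> Poly_Mapping.keys (lead_mono lt p)"
      by (auto simp: u in_keys_iff lookup_add)
    then have "Poly_Mapping.single u c \<in> carrier (poly_ring (edges G))"
      using greatest[OF p(2)] p(1) by (auto simp: toric_ideal_iff poly_ring_def poly_vars_def)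
    moreover have "lead_term lt b \<in> I"
      using I(2) b by blast
    ultimately show ?thesis
      using ideal.I_l_closed[OF I(1)] by (fastforce simp: poly_ring_def)
  qed
  then have "initial_ideal (edges G) lt (toric_ideal G) \<subseteq> initial_ideal (edges G) lt B"
    unfolding initial_ideal_def genideal_def by blast
  moreover have "initial_ideal (edges G) lt B \<subseteq> initial_ideal (edges G) lt (toric_ideal G)"
    unfolding initial_ideal_def genideal_def using B by blast
  ultimately show ?thesis
    using \<open>finite B\<close> B by (auto simp: is_groebner_basis_def)
qed


section \<open>The vertices and edges of the ladder\<close>

text \<open>The numbering of the lines of the array, rows and columns alike, in the order of their
  creation.\<close>

definition path_vertex :: "nat \<Rightarrow> ladder_vertex" where
  "path_vertex k = (if odd k then Row ((k + 1) div 2) else Col (k div 2 + 1))"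

text \<open>\<open>anchor t k\<close> is the earlier endpoint of the edge \<open>2k + 1\<close>.  For \<open>k \<ge> 3\<close> the newest line of the
  array is number \<open>k + 2\<close>, and the edge goes to the first or second entry of line \<open>k\<close>; these
  two entries are the edges \<open>2(k - 2) + 1\<close> and \<open>2(k - 1)\<close>, which lead to \<open>anchor t (k - 2)\<close> and to
  \<open>k - 1\<close>.  The value at \<open>0\<close> is a dummy, since there is no edge \<open>1\<close>.\<close>

fun anchor :: "bit list \<Rightarrow> nat \<Rightarrow> nat" where
  "anchor t 0 = 0"
| "anchor t (Suc 0) = 0"
| "anchor t (Suc (Suc 0)) = 1"
| "anchor t (Suc (Suc (Suc k))) = (if t ! (k + 2) = 0 then anchor t (Suc k) else k + 2)"

text \<open>Edges are seen as joining a later vertex to an earlier one.\<close>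

definition new_end :: "nat \<Rightarrow> nat" where
  "new_end e = (if even e then e div 2 + 1 else e div 2 + 2)"

definition old_end :: "bit list \<Rightarrow> nat \<Rightarrow> nat" where
  "old_end t e = (if even e then e div 2 else anchor t (e div 2))"

text \<open>The position in the array where the lines \<open>k\<close> and \<open>l\<close> cross, meaningful when one of them is a
  row and the other a column.\<close>

definition cell :: "nat \<Rightarrow> nat \<Rightarrow> nat \<times> nat" where
  "cell k l = (if odd k then ((k + 1) div 2, l div 2 + 1) else ((l + 1) div 2, k div 2 + 1))"

definition edge_cell :: "bit list \<Rightarrow> nat \<Rightarrow> nat \<times> nat" where
  "edge_cell t e = cell (new_end e) (old_end t e)"

lemma path_vertex_eq_iff: "path_vertex k = path_vertex l \<longleftrightarrow> k = l"
  by (simp add: path_vertex_def) presburger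

lemma anchor_2: "anchor t 2 = 1"
  by (simp add: numeral_2_eq_2)

lemma anchor_less: "0 < k \<Longrightarrow> anchor t k < k"
  by (induction t k rule: anchor.induct) auto

lemma odd_anchor: "0 < k \<Longrightarrow> odd (anchor t k + k)"
  by (induction t k rule: anchor.induct) auto

lemma anchor_butlast:
  "k < length t \<Longrightarrow> anchor (butlast t) k = anchor t k"
  by (induction t k rule: anchor.induct) (auto simp: nth_butlast)

lemma ladder_vars_cases:
  assumes "e \<in> ladder_vars n"
  obtains (even) k where "k \<le> n + 2" "e = 2 * k"
  | (odd) k where "0 < k" "k \<le> n + 1" "e = 2 * k + 1"
proof (cases "even e")
  case True
  then show ?thesis
    using assms even by (auto simp: ladder_vars_def elim!: evenE)
next
  case False
  then show ?thesis
    using assms odd by (auto simp: ladder_vars_def elim!: oddE)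
qed

lemma old_end_less_new_end:
  "e \<noteq> 1 \<Longrightarrow> old_end t e < new_end e"
  using anchor_less[of "e div 2" t] by (auto simp: old_end_def new_end_def elim!: oddE)

lemma odd_ends:
  "e \<noteq> 1 \<Longrightarrow> odd (old_end t e) \<longleftrightarrow> even (new_end e)"
  using odd_anchor[of "e div 2" t] by (auto simp: old_end_def new_end_def elim!: oddE)

lemma path_vertex_cell:
  assumes "odd l \<longleftrightarrow> even k" and "cell k l = (r, c)"
  shows "{Row r, Col c} = {path_vertex k, path_vertex l}"
  using assms by (auto simp: cell_def path_vertex_def split: if_splits)

lemma cell_eq_iff:
  assumes "l < k" "odd l \<longleftrightarrow> even k" "l' < k'" "odd l' \<longleftrightarrow> even k'"
  shows "cell k l = cell k' l' \<longleftrightarrow> k = k' \<and> l = l'"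
proof
  assume eq: "cell k l = cell k' l'"
  obtain r c where "cell k l = (r, c)"
    by fastforce
  then have "{path_vertex k, path_vertex l} = {path_vertex k', path_vertex l'}"
    using assms(2,4) eq path_vertex_cell by metis
  then show "k = k' \<and> l = l'"
    using assms(1,3) by (auto simp: doubleton_eq_iff path_vertex_eq_iff)
qed simp

text \<open>The only edges between \<open>V\<^sub>k\<close> and earlier vertices are those added with it; of the later edges that
  meet it only \<open>2k\<close> is within the bound, as an edge anchored at \<open>V\<^sub>k\<close> has index at least \<open>2k + 3\<close>.  So the
  choices made by \<open>t\<close> are invisible in this range.\<close>

lemma incident_upto:
  assumes "e \<in> ladder_vars n" and "e \<le> 2 * k"
  shows "k = new_end e \<or> k = old_end t e \<longleftrightarrow> e + 3 = 2 * k \<or> e + 2 = 2 * k \<or> e = 2 * k"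
  using assms(1)
proof (cases rule: ladder_vars_cases)
  case (odd i)
  then show ?thesis
    using anchor_less[of i t] assms(2) by (simp add: new_end_def old_end_def) presburger
next
  case (even i)
  then show ?thesis
    by (simp add: new_end_def old_end_def) presburger
qed


section \<open>The array\<close>

lemma edge_cell_ends:
  assumes "e \<noteq> 1"
  shows "{Row (fst (edge_cell t e)), Col (snd (edge_cell t e))}
    = {path_vertex (new_end e), path_vertex (old_end t e)}"
  using path_vertex_cell[OF odd_ends[OF assms]] by (simp add: edge_cell_def)

lemma edge_cell_incident:
  assumes "e \<noteq> 1"
  shows "odd k \<Longrightarrow> fst (edge_cell t e) = (k + 1) div 2 \<longleftrightarrow> k = new_end e \<or> k = old_end t e"
    and "even k \<Longrightarrow> snd (edge_cell t e) = k div 2 + 1 \<longleftrightarrow> k = new_end e \<or> k = old_end t e"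
proof -
  have mem: "path_vertex k \<in> {Row (fst (edge_cell t e)), Col (snd (edge_cell t e))}
      \<longleftrightarrow> k = new_end e \<or> k = old_end t e"
    unfolding edge_cell_ends[OF assms] by (simp add: path_vertex_eq_iff)
  {
    assume "odd k"
    then show "fst (edge_cell t e) = (k + 1) div 2 \<longleftrightarrow> k = new_end e \<or> k = old_end t e"
      using mem by (auto simp: path_vertex_def)
  next
    assume "even k"
    then show "snd (edge_cell t e) = k div 2 + 1 \<longleftrightarrow> k = new_end e \<or> k = old_end t e"
      using mem by (auto simp: path_vertex_def)
  }
qed

lemma sorted_list_of_set_triple:
  "a < b \<Longrightarrow> b < c \<Longrightarrow> sorted_list_of_set {a, b, c :: nat} = [a, b, c]"
  by simp

text \<open>The line next to the one to be added is number \<open>m + 3\<close>, a column for odd \<open>m\<close> and a row for even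
  \<open>m\<close>; the edges found on it are those of \<open>incident_upto\<close>, because no edge beyond \<open>2(m + 3)\<close>
  exists yet.\<close>

lemma ladder_array_edges_at:
  assumes L: "\<And>p e. L p = Some e \<longleftrightarrow> e \<in> ladder_vars (Suc m) \<and> p = edge_cell t e"
  shows "odd m \<Longrightarrow> {r. L (r, (m + 3) div 2 + 1) \<noteq> None}
           = fst ` edge_cell t ` {2 * m + 3, 2 * m + 4, 2 * m + 6}"
    and "even m \<Longrightarrow> {c. L ((m + 4) div 2, c) \<noteq> None}
           = snd ` edge_cell t ` {2 * m + 3, 2 * m + 4, 2 * m + 6}"
proof -
  let ?E = "{2 * m + 3, 2 * m + 4, 2 * m + 6}"
  have E: "e \<in> ?E \<longleftrightarrow> e \<in> ladder_vars (Suc m) \<and> (m + 3 = new_end e \<or> m + 3 = old_end t e)" for e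
    using incident_upto[of e "Suc m" "m + 3" t] by (auto simp: ladder_vars_def)
  have ne: "e \<noteq> 1" if "e \<in> ladder_vars (Suc m)" for e
    using that by (auto simp: ladder_vars_def)
  {
    assume "odd m"
    then have "e \<in> ?E \<longleftrightarrow> e \<in> ladder_vars (Suc m) \<and> snd (edge_cell t e) = (m + 3) div 2 + 1" for e
      using E[of e] ne[of e] edge_cell_incident(2)[of e "m + 3" t] by auto
    then show "{r. L (r, (m + 3) div 2 + 1) \<noteq> None} = fst ` edge_cell t ` ?E"
      by (force simp: L image_iff prod_eq_iff)
  next
    assume "even m"
    then have "e \<in> ?E \<longleftrightarrow> e \<in> ladder_vars (Suc m) \<and> fst (edge_cell t e) = (m + 4) div 2" for e
      using E[of e] ne[of e] edge_cell_incident(1)[of e "m + 3" t] by auto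
    then show "{c. L ((m + 4) div 2, c) \<noteq> None} = snd ` edge_cell t ` ?E"
      by (force simp: L image_iff prod_eq_iff)
  }
qed

lemma edge_cell_butlast:
  assumes "e \<in> ladder_vars (Suc m)" and "length t = m + 3"
  shows "edge_cell (butlast t) e = edge_cell t e"
  using assms by (cases rule: ladder_vars_cases)
    (auto simp: edge_cell_def old_end_def anchor_butlast)

text \<open>An even and an odd edge with the same later endpoint differ in the earlier one, as an anchor is
  never the immediate predecessor in the path; so the graph has no multiple edges.\<close>

lemma edge_cell_eq_iff:
  assumes "e \<noteq> 1" "f \<noteq> 1"
  shows "edge_cell t e = edge_cell t f \<longleftrightarrow> e = f"
proof -
  have "e = f" if "new_end e = new_end f" "old_end t e = old_end t f"
  proof -
    consider "even e = even f" | "even e" "odd f" | "odd e" "even f"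
      by blast
    then show ?thesis
    proof cases
      case 1
      then show ?thesis
        using that(1) by (auto simp: new_end_def elim!: oddE evenE split: if_splits)
    next
      case 2
      then show ?thesis
        using that anchor_less[of "f div 2" t] assms
        by (auto simp: new_end_def old_end_def elim!: oddE evenE split: if_splits)
    next
      case 3
      then show ?thesis
        using that anchor_less[of "e div 2" t] assms
        by (auto simp: new_end_def old_end_def elim!: oddE evenE split: if_splits)
    qed
  qed
  then show ?thesis
    using assms by (auto simp: edge_cell_def cell_eq_iff old_end_less_new_end odd_ends)
qed

text \<open>The recursive array puts each edge where its two endpoints cross.  In the step, the nonempty
  positions of the last line appear in the order of \<open>anchor t (m + 1)\<close>, \<open>m + 2\<close>, \<open>m + 4\<close>, so the
  bit selects between the first two exactly as in the recursion of \<open>anchor\<close>.\<close>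

lemma ladder_array_eq_Some_iff:
  "length t = n + 1 \<Longrightarrow>
     ladder_array n t p = Some e \<longleftrightarrow> e \<in> ladder_vars n \<and> p = edge_cell t e"
proof (induction n t arbitrary: p e rule: ladder_array.induct)
  case (1 t)
  have "ladder_vars 0 = {0, 2, 3, 4}"
    by (auto simp: ladder_vars_def)
  moreover have "edge_cell t 0 = (1, 1)" "edge_cell t 2 = (1, 2)"
    "edge_cell t 3 = (2, 1)" "edge_cell t 4 = (2, 2)"
    by (simp_all add: edge_cell_def new_end_def old_end_def cell_def)
  ultimately show ?case
    by (auto split: if_splits)
next
  case (2 t)
  have "ladder_vars (Suc 0) = {0, 2, 3, 4, 5, 6}"
    by (auto simp: ladder_vars_def)
  moreover have "edge_cell t 0 = (1, 1)" "edge_cell t 2 = (1, 2)" "edge_cell t 5 = (1, 3)"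
    "edge_cell t 3 = (2, 1)" "edge_cell t 4 = (2, 2)" "edge_cell t 6 = (2, 3)"
    by (simp_all add: edge_cell_def new_end_def old_end_def cell_def anchor_2)
  ultimately show ?case
    by (auto split: if_splits)
next
  case (3 m t)
  let ?L = "ladder_array (Suc m) (butlast t)"
  have L: "?L p = Some e \<longleftrightarrow> e \<in> ladder_vars (Suc m) \<and> p = edge_cell t e" for p e
    using 3 edge_cell_butlast[of e m t] by auto
  have vars: "ladder_vars (Suc (Suc m)) = ladder_vars (Suc m) \<union> {2 * m + 7, 2 * m + 8}"
    by (auto simp: ladder_vars_def)
  have new: "2 * m + 7 \<notin> ladder_vars (Suc m)" "2 * m + 8 \<notin> ladder_vars (Suc m)"
    by (auto simp: ladder_vars_def)
  have anchor: "anchor t (m + 1) < m + 1" "odd (anchor t (m + 1) + m + 1)"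
    using anchor_less[of "m + 1" t] odd_anchor[of "m + 1" t] by auto
  have "e \<noteq> 1" if "e \<in> ladder_vars (Suc (Suc m))" for e
    using that by (auto simp: ladder_vars_def)
  then have inj: "inj_on (edge_cell t) (ladder_vars (Suc (Suc m)))"
    by (auto simp: inj_on_def edge_cell_eq_iff)
  have cells: "edge_cell t (2 * m + 3) = cell (m + 3) (anchor t (m + 1))"
    "edge_cell t (2 * m + 4) = cell (m + 3) (m + 2)"
    "edge_cell t (2 * m + 6) = cell (m + 4) (m + 3)"
    "edge_cell t (2 * m + 8) = cell (m + 5) (m + 4)"
    "edge_cell t (2 * m + 7) = cell (m + 5) (anchor t (m + 3))"
    by (simp_all add: edge_cell_def new_end_def old_end_def) (simp_all add: eval_nat_numeral)
  have step: "ladder_array (Suc (Suc m)) t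
      = ?L(edge_cell t (2 * m + 8) \<mapsto> 2 * m + 8, edge_cell t (2 * m + 7) \<mapsto> 2 * m + 7)"
  proof (cases "even m")
    case True
    have "{c. ?L ((m + 4) div 2, c) \<noteq> None}
        = {anchor t (m + 1) div 2 + 1, (m + 2) div 2 + 1, (m + 4) div 2 + 1}"
      using True anchor(2) by (subst ladder_array_edges_at(2)[OF L]) (auto simp: cells cell_def)
    then have "row_entries ?L ((m + 4) div 2)
        = [anchor t (m + 1) div 2 + 1, (m + 2) div 2 + 1, (m + 4) div 2 + 1]"
      unfolding row_entries_def using True anchor
      by (subst sorted_list_of_set_triple[symmetric]) (auto elim!: evenE)
    then show ?thesis
      using True anchor by (auto simp: Let_def num_rows_def num_cols_def cells cell_def
          numeral_3_eq_3 elim!: evenE)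
  next
    case False
    have "{r. ?L (r, (m + 3) div 2 + 1) \<noteq> None}
        = {(anchor t (m + 1) + 1) div 2, (m + 3) div 2, (m + 5) div 2}"
      using False anchor(2) by (subst ladder_array_edges_at(1)[OF L])
        (auto simp: cells cell_def elim!: oddE)
    then have "col_entries ?L ((m + 3) div 2 + 1)
        = [(anchor t (m + 1) + 1) div 2, (m + 3) div 2, (m + 5) div 2]"
      unfolding col_entries_def using False anchor
      by (subst sorted_list_of_set_triple[symmetric]) (auto elim!: oddE)
    then show ?thesis
      using False anchor by (auto simp: Let_def num_rows_def num_cols_def cells cell_def
          numeral_3_eq_3 elim!: oddE)
  qed
  show ?case
    unfolding step
    using inj new unfolding vars by (auto simp: L inj_on_def)
qed


section \<open>The ladder graph\<close>

lemma ladder_graph_edges: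
  assumes "length t = n + 1"
  shows "edges (ladder_graph n t) = ladder_vars n"
  by (auto simp: ladder_graph_def ran_def ladder_array_eq_Some_iff[OF assms])

lemma ladder_vars_neq_1: "e \<in> ladder_vars n \<Longrightarrow> e \<noteq> 1"
  by (auto simp: ladder_vars_def)

lemma ladder_graph_ends:
  assumes "length t = n + 1" and "e \<in> ladder_vars n"
  shows "ends (ladder_graph n t) e = {path_vertex (new_end e), path_vertex (old_end t e)}"
proof -
  have "(THE p. ladder_array n t p = Some e) = edge_cell t e"
    using assms by (simp add: ladder_array_eq_Some_iff)
  then show ?thesis
    using edge_cell_ends[OF ladder_vars_neq_1[OF assms(2)], of t]
    by (simp add: ladder_graph_def array_ends_def case_prod_beta)
qed

lemma endpoint_mono_ladder_edge:
  assumes "length t = n + 1" and e: "e \<in> ladder_vars n"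
    and "{new_end e, old_end t e} = {k, l}"
  shows "endpoint_mono (ladder_graph n t) (Poly_Mapping.single e 1)
    = Poly_Mapping.single (path_vertex k) 1 + Poly_Mapping.single (path_vertex l) 1"
proof -
  have "path_vertex (new_end e) \<noteq> path_vertex (old_end t e)"
    using old_end_less_new_end[OF ladder_vars_neq_1[OF e], of t] by (simp add: path_vertex_eq_iff)
  then show ?thesis
    using assms(3)
    by (auto simp: endpoint_mono_single ladder_graph_ends[OF assms(1) e] doubleton_eq_iff
        add.commute simp del: One_nat_def)
qed


section \<open>The Groebner basis\<close>

text \<open>At the last index where the monomials differ, compare the degrees at the vertices whose remaining
  edges are few: one edge for odd indices and for the indices \<open>0\<close> and \<open>2\<close>, which excludes a
  difference, and the pair \<open>V\<^sub>i\<^sub>+\<^sub>3\<close>, \<open>V\<^sub>i\<^sub>+\<^sub>2\<close> for the index \<open>2i + 4\<close>.\<close>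

lemma standard_monomial_least_in_fibre:
  assumes t: "length t = n + 1"
    and keys: "Poly_Mapping.keys m \<subseteq> ladder_vars n" "Poly_Mapping.keys m' \<subseteq> ladder_vars n"
    and eq: "endpoint_mono (ladder_graph n t) m = endpoint_mono (ladder_graph n t) m'"
    and "m \<noteq> m'"
    and standard: "\<And>i. i \<le> n \<Longrightarrow> Poly_Mapping.lookup m (2 * i + 3) = 0 \<or>
      Poly_Mapping.lookup m (2 * i + 1) = 0 \<and> Poly_Mapping.lookup m (2 * i + 2) = 0"
  shows "degrevlex m m'"
proof (rule degrevlex_if_last_difference[OF _ \<open>m \<noteq> m'\<close>])
  let ?G = "ladder_graph n t"
  have fin: "finite (ladder_vars n)"
    by (simp add: ladder_vars_def)
  have "card (ends ?G e) = 2" if "e \<in> ladder_vars n" for e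
    using old_end_less_new_end[OF ladder_vars_neq_1[OF that], of t]
    by (simp add: ladder_graph_ends[OF t that] path_vertex_eq_iff)
  then show "mono_deg m = mono_deg m'"
    using keys eq by (intro mono_deg_eq_if_endpoint_mono_eq) auto
  fix v
  assume differ: "Poly_Mapping.lookup m v \<noteq> Poly_Mapping.lookup m' v"
    and agree: "\<forall>w>v. Poly_Mapping.lookup m w = Poly_Mapping.lookup m' w"
  \<comment> \<open>The vertex degrees agree, and so do the parts of them that come from edges after \<open>v\<close>.\<close>
  have sums: "sum (Poly_Mapping.lookup m) E = sum (Poly_Mapping.lookup m') E"
    if "finite E" "v \<le> 2 * k" and E_iff: "\<And>e. e \<in> ladder_vars n \<Longrightarrow>
        e \<in> E \<longleftrightarrow> e \<le> v \<and> (e + 3 = 2 * k \<or> e + 2 = 2 * k \<or> e = 2 * k)" for E k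
  proof -
    have E: "e \<in> E \<longleftrightarrow> e \<le> v \<and> (k = new_end e \<or> k = old_end t e)" if "e \<in> ladder_vars n" for e
      using E_iff[OF that] incident_upto[OF that, of k t] \<open>v \<le> 2 * k\<close> by auto
    let ?I = "{e \<in> ladder_vars n. k = new_end e \<or> k = old_end t e}"
    have split: "sum (Poly_Mapping.lookup q) ?I
        = sum (Poly_Mapping.lookup q) E + sum (Poly_Mapping.lookup q) {e \<in> ?I. v < e}"
      if "Poly_Mapping.keys q \<subseteq> ladder_vars n" for q :: "nat monomial"
    proof -
      have "sum (Poly_Mapping.lookup q) E = sum (Poly_Mapping.lookup q) {e \<in> ?I. e \<le> v}"
      proof (rule sum.mono_neutral_right)
        show "\<forall>e\<in>E - {e \<in> ?I. e \<le> v}. Poly_Mapping.lookup q e = 0"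
        proof
          fix e
          assume "e \<in> E - {e \<in> ?I. e \<le> v}"
          then have "e \<notin> ladder_vars n"
            using E by blast
          then show "Poly_Mapping.lookup q e = 0"
            using that in_keys_iff[of e q] by blast
        qed
      qed (use \<open>finite E\<close> E in auto)
      moreover have "sum (Poly_Mapping.lookup q) ?I = sum (Poly_Mapping.lookup q)
          ({e \<in> ?I. e \<le> v} \<union> {e \<in> ?I. v < e})"
        by (rule sum.cong) auto
      ultimately show ?thesis
        using fin by (subst (asm) sum.union_disjoint) auto
    qed
    have degree: "Poly_Mapping.lookup (endpoint_mono ?G q) (path_vertex k)
        = sum (Poly_Mapping.lookup q) ?I" if "Poly_Mapping.keys q \<subseteq> ladder_vars n" for q
      using fin that by (subst lookup_endpoint_mono[of "ladder_vars n"])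
        (auto simp: ladder_graph_ends[OF t] path_vertex_eq_iff intro!: sum.cong)
    have "sum (Poly_Mapping.lookup m) {e \<in> ?I. v < e} = sum (Poly_Mapping.lookup m') {e \<in> ?I. v < e}"
      using agree by (intro sum.cong) auto
    then show ?thesis
      using split[OF keys(1)] split[OF keys(2)] degree[OF keys(1)] degree[OF keys(2)] eq by simp
  qed
  have "v \<in> ladder_vars n"
    using differ keys by (metis in_keys_iff subsetD)
  then show "Poly_Mapping.lookup m' v < Poly_Mapping.lookup m v"
  proof (cases rule: ladder_vars_cases)
    case (odd k)
    have "sum (Poly_Mapping.lookup m) {v} = sum (Poly_Mapping.lookup m') {v}"
      using odd by (intro sums[where k = "k + 2"]) auto
    then show ?thesis
      using differ by simp
  next
    case (even k)
    show ?thesis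
    proof (cases "k \<le> 1")
      case True
      have "sum (Poly_Mapping.lookup m) {v} = sum (Poly_Mapping.lookup m') {v}"
      proof (rule sums[where k = "k + 1"])
        fix e
        assume "e \<in> ladder_vars n"
        then have "e \<noteq> 1"
          by (rule ladder_vars_neq_1)
        then show "e \<in> {v} \<longleftrightarrow>
            e \<le> v \<and> (e + 3 = 2 * (k + 1) \<or> e + 2 = 2 * (k + 1) \<or> e = 2 * (k + 1))"
          using even True unfolding singleton_iff by presburger
      qed (use even in auto)
      then show ?thesis
        using differ by simp
    next
      case False
      define i where "i = k - 2"
      have v: "v = 2 * i + 4" and i: "i \<le> n"
        using False even by (auto simp: i_def)
      have "sum (Poly_Mapping.lookup m) {2 * i + 3, 2 * i + 4}
          = sum (Poly_Mapping.lookup m') {2 * i + 3, 2 * i + 4}"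
        by (intro sums[where k = "i + 3"]) (auto simp: v)
      moreover have "sum (Poly_Mapping.lookup m) {2 * i + 1, 2 * i + 2, 2 * i + 4}
          = sum (Poly_Mapping.lookup m') {2 * i + 1, 2 * i + 2, 2 * i + 4}"
        by (intro sums[where k = "i + 2"]) (auto simp: v)
      ultimately show ?thesis
        using standard[OF i] differ by (auto simp: v)
    qed
  qed
qed

text \<open>The variables \<open>j\<close> close the 4-cycles: \<open>x\<^sub>2\<^sub>i\<^sub>+\<^sub>1\<close> and \<open>x\<^sub>2\<^sub>i\<^sub>+\<^sub>3\<close> end in the anchors of \<open>i\<close> and \<open>i + 1\<close>, and
  \<open>x\<^sub>2\<^sub>i\<^sub>+\<^sub>2\<close> in \<open>V\<^sub>i\<^sub>+\<^sub>1\<close>, so \<open>j (2i)\<close> has to join the two anchors and \<open>j (2i + 1)\<close> to join \<open>V\<^sub>i\<^sub>+\<^sub>1\<close> to the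
  anchor of \<open>i + 1\<close>.  The recursions of \<open>j\<close> and of \<open>anchor\<close> follow the same bit: the anchor of
  \<open>i + 1\<close> is that of \<open>i - 1\<close> or the vertex \<open>i\<close>, and the edges from either of them to the anchor of
  \<open>i\<close> are \<open>j (2i - 2)\<close> and \<open>j (2i - 1)\<close>.\<close>

lemma ladder_index:
  assumes "j 1 = 0" and "j 2 = 0" and "j 3 = 2"
    and "\<And>i. 2 \<le> i \<Longrightarrow> i \<le> n \<Longrightarrow> t ! i = 0 \<Longrightarrow>
           j (2 * i) = j (2 * i - 2) \<and> j (2 * i + 1) = 2 * i - 1"
    and "\<And>i. 2 \<le> i \<Longrightarrow> i \<le> n \<Longrightarrow> t ! i = 1 \<Longrightarrow>
           j (2 * i) = j (2 * i - 1) \<and> j (2 * i + 1) = 2 * i"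
    and "1 \<le> i" and "i \<le> n"
  shows "{new_end (j (2 * i)), old_end t (j (2 * i))} = {anchor t i, anchor t (i + 1)}
      \<and> {new_end (j (2 * i + 1)), old_end t (j (2 * i + 1))} = {i + 1, anchor t (i + 1)}
      \<and> j (2 * i) \<in> insert 0 {2..2 * i} \<and> j (2 * i + 1) \<in> insert 0 {2..2 * i}"
  using assms(6,7)
proof (induction i rule: dec_induct)
  case base
  then show ?case
    using assms(2,3) by (auto simp: new_end_def old_end_def anchor_2)
next
  case (step i)
  have prev: "j (2 * Suc i - 2) = j (2 * i)" "j (2 * Suc i - 1) = j (2 * i + 1)"
    by simp_all
  obtain k where k: "i = Suc k"
    using step.hyps(1) by (cases i) auto
  consider "t ! Suc i = 0" | "t ! Suc i = 1"
    by (metis bit_not_zero_iff)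
  then show ?case
  proof cases
    case 1
    then have "j (2 * Suc i) = j (2 * i)" "j (2 * Suc i + 1) = 2 * i + 1"
      using assms(4)[of "Suc i"] step.hyps(1) step.prems unfolding prev by auto
    moreover have "anchor t (Suc i + 1) = anchor t i"
      using 1 by (simp add: k)
    ultimately show ?thesis
      using step by (auto simp: new_end_def old_end_def)
  next
    case 2
    then have "j (2 * Suc i) = j (2 * i + 1)" "j (2 * Suc i + 1) = 2 * Suc i"
      using assms(5)[of "Suc i"] step.hyps(1) step.prems unfolding prev by auto
    moreover have "anchor t (Suc i + 1) = Suc i"
      using 2 by (simp add: k)
    ultimately show ?thesis
      using step by (auto simp: new_end_def old_end_def)
  qed
qed

theorem lemma3p1:
  fixes n :: nat and t :: "bit list"
    and j :: "nat \<Rightarrow> nat" and s :: "nat \<Rightarrow> (nat, 'k::field) mpoly"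
  assumes "length t = n + 1"
    and "j 1 = 0" and "j 2 = 0" and "j 3 = 2"
    and "\<And>i. 2 \<le> i \<Longrightarrow> i \<le> n \<Longrightarrow> t ! i = 0 \<Longrightarrow>
           j (2 * i) = j (2 * i - 2) \<and> j (2 * i + 1) = 2 * i - 1"
    and "\<And>i. 2 \<le> i \<Longrightarrow> i \<le> n \<Longrightarrow> t ! i = 1 \<Longrightarrow>
           j (2 * i) = j (2 * i - 1) \<and> j (2 * i + 1) = 2 * i"
    and "s 1 = pvar 2 * pvar 3 - pvar (j 1) * pvar 4"
    and "\<And>i. 1 \<le> i \<Longrightarrow> i \<le> n \<Longrightarrow>
           s (2 * i) = pvar (2 * i + 1) * pvar (2 * i + 3) - pvar (j (2 * i)) * pvar (2 * i + 4)"
    and "\<And>i. 1 \<le> i \<Longrightarrow> i \<le> n \<Longrightarrow>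
           s (2 * i + 1) =
             pvar (2 * i + 2) * pvar (2 * i + 3) - pvar (j (2 * i + 1)) * pvar (2 * i + 4)"
  shows "is_groebner_basis (ladder_vars n) degrevlex (s ` {1..2 * n + 1})
           (toric_ideal (ladder_graph n t))"
proof -
  let ?G = "ladder_graph n t"
  let ?q = "\<lambda>a b. Poly_Mapping.single a 1 + Poly_Mapping.single b 1 :: nat monomial"
  note t = assms(1)
  have asym: "\<not> degrevlex q p" if "degrevlex p q" for p q :: "nat monomial"
    using that degrevlex_trans degrevlex_irrefl by blast
  \<comment> \<open>\<open>a\<close>, \<open>c\<close>, \<open>b\<close>, \<open>d\<close> are the successive edges of the 4-cycle through \<open>x, y, w, z\<close>, and \<open>d\<close> is
    the last variable, which makes \<open>c d\<close> the smaller product.\<close>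
  have quadric: "p \<in> toric_ideal ?G \<and> p \<noteq> 0 \<and> lead_mono degrevlex p = ?q a b"
    if p: "p = pvar a * pvar b - pvar c * pvar d"
      and vars: "{a, b, c, d} \<subseteq> ladder_vars n" and less: "a < d" "b < d" "c < d"
      and ends: "{new_end a, old_end t a} = {x, y}" "{new_end b, old_end t b} = {z, w}"
        "{new_end c, old_end t c} = {y, w}" "{new_end d, old_end t d} = {x, z}"
    for p :: "(nat, 'k) mpoly" and a b c d x y z w
  proof (intro conjI)
    have p: "p = Poly_Mapping.single (?q a b) 1 - Poly_Mapping.single (?q c d) 1"
      by (simp only: p pvar_mult)
    have lt: "degrevlex (?q c d) (?q a b)"
      using degrevlex_quadric[OF less] .
    show "lead_mono degrevlex p = ?q a b"
      unfolding p using lt by (intro lead_mono_binomial asym)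
    have "?q a b \<noteq> ?q c d"
      using lt degrevlex_irrefl by metis
    then have "Poly_Mapping.lookup p (?q a b) = 1"
      unfolding p by (simp add: lookup_minus lookup_single)
    then show "p \<noteq> 0"
      by auto
    have "endpoint_mono ?G (?q a b) = endpoint_mono ?G (?q c d)"
      using vars by (simp add: endpoint_mono_add add_ac
          endpoint_mono_ladder_edge[OF t _ ends(1)] endpoint_mono_ladder_edge[OF t _ ends(2)]
          endpoint_mono_ladder_edge[OF t _ ends(3)] endpoint_mono_ladder_edge[OF t _ ends(4)]
          del: One_nat_def)
    then show "p \<in> toric_ideal ?G"
      unfolding p using vars
      by (intro binomial_in_toric_ideal)
        (auto simp: ladder_graph_edges[OF t] in_keys_iff lookup_add lookup_single when_def split: if_splits)
  qed
  have even: "s (2 * i) \<in> toric_ideal ?G \<and> s (2 * i) \<noteq> 0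
      \<and> lead_mono degrevlex (s (2 * i)) = ?q (2 * i + 1) (2 * i + 3)"
    if i: "1 \<le> i" "i \<le> n" for i
  proof (rule quadric[OF assms(8)[OF i]])
    note index = ladder_index[where t = t, OF assms(2-6) i]
    have "j (2 * i) \<in> insert 0 {2..2 * i}"
      using index by blast
    then show "{2 * i + 1, 2 * i + 3, j (2 * i), 2 * i + 4} \<subseteq> ladder_vars n"
      "j (2 * i) < 2 * i + 4"
      using i by (auto simp: ladder_vars_def)
    show "{new_end (j (2 * i)), old_end t (j (2 * i))} = {anchor t i, anchor t (i + 1)}"
      using index by blast
    show "{new_end (2 * i + 1), old_end t (2 * i + 1)} = {i + 2, anchor t i}"
      "{new_end (2 * i + 3), old_end t (2 * i + 3)} = {i + 3, anchor t (i + 1)}"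
      "{new_end (2 * i + 4), old_end t (2 * i + 4)} = {i + 2, i + 3}"
      by (auto simp: new_end_def old_end_def)
  qed simp_all
  have odd: "s (2 * i + 1) \<in> toric_ideal ?G \<and> s (2 * i + 1) \<noteq> 0
      \<and> lead_mono degrevlex (s (2 * i + 1)) = ?q (2 * i + 2) (2 * i + 3)"
    if i: "i \<le> n" for i
  proof (rule quadric)
    have index: "{new_end (j (2 * i + 1)), old_end t (j (2 * i + 1))} = {i + 1, anchor t (i + 1)}
        \<and> j (2 * i + 1) \<in> insert 0 {2..2 * i}"
    proof (cases "i = 0")
      case True
      then show ?thesis
        using assms(2) by (simp add: new_end_def old_end_def)
    next
      case False
      then have "1 \<le> i"
        by simp
      from ladder_index[where t = t, OF assms(2-6) this i] show ?thesis
        by blast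
    qed
    show "s (2 * i + 1)
        = pvar (2 * i + 2) * pvar (2 * i + 3) - pvar (j (2 * i + 1)) * pvar (2 * i + 4)"
      using assms(7) assms(9)[of i] i by (cases "i = 0") (simp_all flip: numeral_2_eq_2)
    have "j (2 * i + 1) \<in> insert 0 {2..2 * i}"
      using index by blast
    then show "{2 * i + 2, 2 * i + 3, j (2 * i + 1), 2 * i + 4} \<subseteq> ladder_vars n"
      "j (2 * i + 1) < 2 * i + 4"
      using i by (auto simp: ladder_vars_def)
    show "{new_end (j (2 * i + 1)), old_end t (j (2 * i + 1))} = {i + 1, anchor t (i + 1)}"
      using index by blast
    show "{new_end (2 * i + 2), old_end t (2 * i + 2)} = {i + 2, i + 1}"
      "{new_end (2 * i + 3), old_end t (2 * i + 3)} = {i + 3, anchor t (i + 1)}"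
      "{new_end (2 * i + 4), old_end t (2 * i + 4)} = {i + 2, i + 3}"
      by (auto simp: new_end_def old_end_def)
  qed simp_all
  have "is_groebner_basis (edges ?G) degrevlex (s ` {1..2 * n + 1}) (toric_ideal ?G)"
  proof (rule toric_groebner_criterion[OF degrevlex_trans degrevlex_irrefl degrevlex_total])
    show "s ` {1..2 * n + 1} \<subseteq> toric_ideal ?G"
    proof
      fix p
      assume "p \<in> s ` {1..2 * n + 1}"
      then obtain l where l: "p = s l" "1 \<le> l" "l \<le> 2 * n + 1"
        by auto
      show "p \<in> toric_ideal ?G"
      proof (cases "even l")
        case True
        then show ?thesis
          using l even[of "l div 2"] by (auto elim!: evenE)
      next
        case False
        then show ?thesis
          using l odd[of "l div 2"] by (auto elim!: oddE)
      qed
    qed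
  next
    fix m m' :: "nat monomial"
    assume keys: "Poly_Mapping.keys m \<subseteq> edges ?G" "Poly_Mapping.keys m' \<subseteq> edges ?G"
      and eq: "endpoint_mono ?G m' = endpoint_mono ?G m" and "m' \<noteq> m"
      and standard: "\<And>b u. b \<in> s ` {1..2 * n + 1} \<Longrightarrow> b \<noteq> 0 \<Longrightarrow> m \<noteq> lead_mono degrevlex b + u"
    show "degrevlex m m'"
    proof (rule standard_monomial_least_in_fibre[OF t])
      fix i
      assume i: "i \<le> n"
      have "Poly_Mapping.lookup m (2 * i + 3) = 0 \<or> Poly_Mapping.lookup m (2 * i + 2) = 0"
      proof (rule ccontr)
        assume "\<not> ?thesis"
        then obtain u where "m = ?q (2 * i + 2) (2 * i + 3) + u"
          using exists_monomial_quotient[of "2 * i + 2" "2 * i + 3" m] by auto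
        then show False
          using standard[of "s (2 * i + 1)" u] odd[OF i] i by auto
      qed
      moreover have "Poly_Mapping.lookup m (2 * i + 3) = 0 \<or> Poly_Mapping.lookup m (2 * i + 1) = 0"
      proof (cases "i = 0")
        \<comment> \<open>The variable with index \<open>1\<close> does not exist.\<close>
        case True
        then show ?thesis
          using keys(1) ladder_vars_neq_1 by (force simp: ladder_graph_edges[OF t] in_keys_iff)
      next
        case False
        show ?thesis
        proof (rule ccontr)
          assume "\<not> ?thesis"
          then obtain u where "m = ?q (2 * i + 1) (2 * i + 3) + u"
            using exists_monomial_quotient[of "2 * i + 1" "2 * i + 3" m] by auto
          then show False
            using standard[of "s (2 * i)" u] even[of i] i False by auto
        qed
      qed
      ultimately show "Poly_Mapping.lookup m (2 * i + 3) = 0 \<or>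
          Poly_Mapping.lookup m (2 * i + 1) = 0 \<and> Poly_Mapping.lookup m (2 * i + 2) = 0"
        by blast
    qed (use keys eq \<open>m' \<noteq> m\<close> in \<open>simp_all add: ladder_graph_edges[OF t]\<close>)
  qed simp_all
  then show ?thesis
    by (simp add: ladder_graph_edges[OF t])
qed

end
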